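(* Let $q$ be a complex number with $|q|<1$ and let $x$ and $y$ be complex numbers. Then \[ \sum_{j,\,k,\,\ell\,\geq0}\frac{(x;q)_j(-x)^{k+2\ell}y^{k+\ell}}{(q;q)_j(q;q)_k(q^2;q^2)_{\ell}} q^{j+\binom{k}{2}+\binom{j+k+2\ell}{2}} =(qx,xy;q^2)_{\infty}(-q;q)_{\infty}. \]
   Context: For complex $a$ and $|q|<1$, $(a;q)_\infty=\prod_{i=0}^{\infty}(1-aq^i)$, $(a;q)_n=(a;q)_\infty/(aq^n;q)_\infty$ for nonnegative integers $n$, and $(a_1,\dots,a_r;q)_n=(a_1;q)_n\cdots(a_r;q)_n$ (also for $n=\infty$). $\binom{n}{2}=n(n-1)/2$. *)

theory Defs
  imports "HOL-Analysis.Analysis"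
begin

definition qpoch_inf :: "complex \<Rightarrow> complex \<Rightarrow> complex" where
  "qpoch_inf a q = prodinf (\<lambda>i. 1 - a * q ^ i)"

(* The quotient (a;q)_inf / (a q^n;q)_inf is 0/0 when a q^m = 1 for some m >= n.
   The finite product below is its usual reading there; elsewhere the two agree
   (qpoch_eq_quotient). *)
definition qpoch :: "complex \<Rightarrow> complex \<Rightarrow> nat \<Rightarrow> complex" where
  "qpoch a q n = (\<Prod>i<n. 1 - a * q ^ i)"

lemma convergent_prod_qpoch_inf:
  fixes a q :: complex
  assumes "norm q < 1"
  shows "convergent_prod (\<lambda>i. 1 - a * q ^ i)"
proof -
  have "summable (\<lambda>i. norm a * norm q ^ i)"
    using assms by (intro summable_mult summable_geometric) simp
  hence "summable (\<lambda>i. norm ((1 - a * q ^ i) - 1))"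
    by (simp add: norm_mult norm_power)
  thus ?thesis
    by (intro abs_convergent_prod_imp_convergent_prod summable_imp_abs_convergent_prod)
qed

lemma qpoch_inf_split:
  assumes "norm q < 1"
  shows "qpoch_inf a q = qpoch a q n * qpoch_inf (a * q ^ n) q"
proof -
  define f where "f = (\<lambda>i. 1 - a * q ^ i)"
  have lim1: "(\<lambda>m. \<Prod>i\<le>m. f i) \<longlonglongrightarrow> qpoch_inf a q"
    unfolding qpoch_inf_def f_def
    by (intro convergent_prod_LIMSEQ convergent_prod_qpoch_inf assms)
  have lim2: "(\<lambda>m. \<Prod>i\<le>m. 1 - (a * q ^ n) * q ^ i) \<longlonglongrightarrow> qpoch_inf (a * q ^ n) q"
    unfolding qpoch_inf_def
    by (intro convergent_prod_LIMSEQ convergent_prod_qpoch_inf assms)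
  have split: "(\<Prod>i\<le>m + n. f i) = qpoch a q n * (\<Prod>i\<le>m. 1 - (a * q ^ n) * q ^ i)" for m
  proof (induction m)
    case 0
    show ?case by (simp add: qpoch_def f_def flip: lessThan_Suc_atMost)
  next
    case (Suc m)
    have "f (Suc (m + n)) = 1 - (a * q ^ n) * q ^ Suc m"
      by (simp add: f_def power_add mult_ac)
    with Suc show ?case by (simp add: mult.assoc)
  qed
  have "(\<lambda>m. \<Prod>i\<le>m + n. f i) \<longlonglongrightarrow> qpoch a q n * qpoch_inf (a * q ^ n) q"
    unfolding split by (intro tendsto_mult tendsto_const lim2)
  moreover have "(\<lambda>m. \<Prod>i\<le>m + n. f i) \<longlonglongrightarrow> qpoch_inf a q"
    using lim1 by (rule LIMSEQ_ignore_initial_segment)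
  ultimately show ?thesis by (rule LIMSEQ_unique[symmetric])
qed

lemma qpoch_eq_quotient:
  assumes "norm q < 1" "qpoch_inf (a * q ^ n) q \<noteq> 0"
  shows "qpoch a q n = qpoch_inf a q / qpoch_inf (a * q ^ n) q"
  using qpoch_inf_split[OF assms(1), of a n] assms(2) by simp

end

(*
  Put A(z) = (xqz, xyz; q)_inf / ((qz; q)_inf (x^2 y z^2; q^2)_inf) and let U be the linear functional
  z^n |-> q^(n choose 2). By the q-binomial theorem and Euler's expansions the triple sum is
  F(x, y) = U(A). Since U(z f(z)) = U(f(qz)), every f gives the relation U(z f(z) - f(qz)) = 0.
  With B(z) = A(z) / ((1 - xyz)(1 - xyqz)), the choice f(z) = -xy (1 - xz)(1 - xyqz) B(z) yields
  F(x, y) = (1 - xy) F(x, y q^2). For y = 0, with B(z) = A(z) / ((1 - xqz)(1 - xq^2 z)), the choice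
  f(z) = -qx (1 - xq^2 z) B(z) yields F(x, 0) = (1 - qx) F(x q^2, 0). Iterating and using continuity
  of F, F(x, y) = (xy, qx; q^2)_inf F(0, 0). Finally F(1, 0) = 1 and Euler's identity
  (q; q^2)_inf (-q; q)_inf = 1 give F(0, 0) = (-q; q)_inf.
*)

theory Submission
  imports Defs
begin

unbundle no vec_syntax
unbundle fps_syntax

section \<open>Finite q-Pochhammer symbols and their norm estimates\<close>

lemma qpoch_0 [simp]: "qpoch a q 0 = 1"
  by (simp add: qpoch_def)

lemma qpoch_Suc: "qpoch a q (Suc n) = qpoch a q n * (1 - a * q ^ n)"
  by (simp add: qpoch_def)

lemma qpoch_rec: "qpoch a q (Suc n) = (1 - a) * qpoch (a * q) q n"
  unfolding qpoch_def prod.lessThan_Suc_shift by (simp add: mult.assoc)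

lemma power_choose_Suc: "(q::'a::monoid_mult) ^ (Suc n choose 2) = q ^ (n choose 2) * q ^ n"
  by (simp add: numeral_2_eq_2 power_add[symmetric] add.commute)

lemma power_uminus_mult: "(- (a * b)) ^ n = (- a) ^ n * (b::'a::comm_ring_1) ^ n"
  by (simp flip: power_mult_distrib)

lemma qpoch_LIMSEQ:
  assumes "norm q < 1"
  shows "qpoch a q \<longlonglongrightarrow> qpoch_inf a q"
  using convergent_prod_LIMSEQ[OF convergent_prod_qpoch_inf[OF assms, of a]]
  unfolding qpoch_inf_def qpoch_def
  \<comment> \<open>The partial products of \<open>prodinf\<close> run over \<open>{..m}\<close>,
    which is \<open>qpoch a q (Suc m)\<close>; hence the shift by one.\<close>
  by (subst filterlim_sequentially_Suc[symmetric]) (simp add: lessThan_Suc_atMost)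

lemma norm_power_less_one:
  fixes q :: "'a::real_normed_div_algebra"
  assumes "norm q < 1" "n > 0"
  shows "norm (q ^ n) < 1"
  using assms power_less_one_iff[of "norm q" n] by (simp add: norm_power)

lemma qpoch_self_nonzero:
  assumes "norm q < 1"
  shows "qpoch q q n \<noteq> 0"
proof -
  have "q * q ^ i \<noteq> 1" for i
    using norm_power_less_one[OF assms, of "Suc i"] by auto
  then show ?thesis by (auto simp: qpoch_def)
qed

lemma norm_qpoch_le:
  assumes "norm q \<le> 1"
  shows "norm (qpoch a q n) \<le> (1 + norm a) ^ n"
proof -
  have "norm (1 - a * q ^ i) \<le> 1 + norm a" for i
  proof -
    have "norm (a * q ^ i) \<le> norm a * 1"
      unfolding norm_mult using assms by (intro mult_left_mono) (auto simp: norm_power power_le_one)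
    then show ?thesis using norm_triangle_ineq4[of 1 "a * q ^ i"] by simp
  qed
  then have "(\<Prod>i<n. norm (1 - a * q ^ i)) \<le> (\<Prod>i<n. 1 + norm a)"
    by (intro prod_mono) auto
  then show ?thesis by (simp add: qpoch_def prod_norm)
qed

text \<open>Each factor has norm at least \<open>1 - norm q\<close>, so the reciprocals of
  \<open>qpoch q q n\<close> grow at most geometrically in n.\<close>

lemma norm_qpoch_self_ge:
  assumes "norm q < 1"
  shows "norm (qpoch q q n) \<ge> (1 - norm q) ^ n"
proof -
  have "norm (1 - q * q ^ i) \<ge> 1 - norm q" for i
  proof -
    have "norm (q * q ^ i) \<le> norm q * 1"
      unfolding norm_mult using assms by (intro mult_left_mono) (auto simp: norm_power power_le_one)
    then show ?thesis using norm_triangle_ineq2[of 1 "q * q ^ i"] by simp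
  qed
  then have "(\<Prod>i<n. 1 - norm q) \<le> (\<Prod>i<n. norm (1 - q * q ^ i))"
    using assms by (intro prod_mono) auto
  then show ?thesis by (simp add: qpoch_def prod_norm)
qed

text \<open>Consecutive terms have ratio \<open>c * r ^ n\<close>, which tends to 0. The ratio test
  makes the sequence summable, hence bounded: the quadratic exponent beats every geometric
  growth.\<close>

lemma power_times_power_choose_bounded:
  fixes c r :: real
  assumes "0 \<le> r" "r < 1" "0 \<le> c"
  shows "\<exists>K\<ge>0. \<forall>n. c ^ n * r ^ (n choose 2) \<le> K"
proof -
  define u where "u = (\<lambda>n. c ^ n * r ^ (n choose 2))"
  have u0: "u n \<ge> 0" for n using assms by (simp add: u_def)
  have "(\<lambda>n. c * r ^ n) \<longlonglongrightarrow> c * 0"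
    using assms by (intro tendsto_intros) auto
  then have "eventually (\<lambda>n. c * r ^ n < 1 / 2) sequentially"
    by (rule order_tendstoD) simp
  then obtain N where N: "\<And>n. n \<ge> N \<Longrightarrow> c * r ^ n < 1 / 2"
    by (auto simp: eventually_sequentially)
  have "summable u"
  proof (rule summable_ratio_test[where c = "1/2" and N = N])
    fix n assume "n \<ge> N"
    have "u (Suc n) = (c * r ^ n) * u n"
      by (simp add: u_def power_choose_Suc)
    also have "\<dots> \<le> 1 / 2 * u n"
      using N[OF \<open>n \<ge> N\<close>] u0 by (intro mult_right_mono) auto
    finally show "norm (u (Suc n)) \<le> 1 / 2 * norm (u n)"
      using u0 by simp
  qed simp
  then have "Bseq u"
    by (intro convergent_imp_Bseq convergentI[of _ 0] summable_LIMSEQ_zero)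
  then obtain K where "K > 0" "\<And>n. norm (u n) \<le> K" by (auto simp: Bseq_def)
  then show ?thesis
    unfolding u_def by (intro exI[of _ K]) (auto dest: order.trans[OF abs_ge_self])
qed

section \<open>Unconditional sums over triples of natural numbers\<close>

lemma summable_on_half_powers:
  "(\<lambda>(j, k, l). (1 / 2) ^ j * ((1 / 2) ^ k * (1 / 2) ^ l) :: real) summable_on (UNIV :: (nat \<times> nat \<times> nat) set)"
proof -
  have s: "((\<lambda>n. (1/2::real) ^ n) has_sum 2) UNIV"
    using sums_nonneg_imp_has_sum[OF geometric_sums[of "1/2::real"]] by simp
  have 1: "(\<lambda>(k, l). (1 / 2) ^ k * (1 / 2) ^ l :: real) summable_on (UNIV \<times> (UNIV :: nat set))"
    by (rule summable_on_SigmaI[where g = "\<lambda>k::nat. (1/2) ^ k * 2"])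
       (auto intro!: has_sum_cmult_right s summable_on_cmult_left has_sum_imp_summable[OF s])
  then obtain S where S: "((\<lambda>(k, l). (1 / 2) ^ k * (1 / 2) ^ l :: real) has_sum S) (UNIV :: (nat \<times> nat) set)"
    by (auto simp: summable_on_def)
  have "(\<lambda>(j, p). (1 / 2) ^ j * (case p of (k, l) \<Rightarrow> (1 / 2) ^ k * (1 / 2) ^ l) :: real)
          summable_on (UNIV \<times> (UNIV :: (nat \<times> nat) set))"
    by (rule summable_on_SigmaI[where g = "\<lambda>j::nat. (1/2) ^ j * S"])
       (auto intro!: has_sum_cmult_right S summable_on_cmult_left has_sum_imp_summable[OF s])
  then show ?thesis by (simp add: case_prod_unfold)
qed

text \<open>A triple (j, k, m) is recovered from (n, j, k) with n = j + k + m, and each n has a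
  finite fibre. The inner sums then have the shape of a threefold Cauchy product.\<close>

lemma has_sum_by_total_degree:
  fixes f :: "nat \<times> nat \<times> nat \<Rightarrow> 'a :: {topological_comm_monoid_add, t3_space}"
  assumes "(f has_sum S) UNIV"
  shows "((\<lambda>n. \<Sum>j\<le>n. \<Sum>k\<le>n - j. f (j, k, n - j - k)) has_sum S) UNIV"
proof (rule has_sum_SigmaD)
  let ?B = "\<lambda>n. Sigma {..n} (\<lambda>j. {..n - j})"
  let ?f = "\<lambda>(n, j, k). f (j, k, n - j - k)"
  show "(?f has_sum S) (Sigma UNIV ?B)"
    by (rule iffD2[OF has_sum_reindex_bij_witness[of _ "\<lambda>(j, k, m). (j + k + m, j, k)"
          "\<lambda>(n, j, k). (j, k, n - j - k)" UNIV f] assms]) auto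
  show "((\<lambda>p. ?f (n, p)) has_sum (\<Sum>j\<le>n. \<Sum>k\<le>n - j. f (j, k, n - j - k))) (?B n)" for n
    by (rule has_sum_finiteI) (auto simp: sum.Sigma intro!: sum.cong)
qed

section \<open>Cauchy products and power series of positive radius of convergence\<close>

lemma fps_mult3_nth:
  "(f * (g * h)) $ n = (\<Sum>j\<le>n. \<Sum>k\<le>n - j. f $ j * (g $ k * h $ (n - j - k)))"
  for f g h :: "'a::semiring_0 fps"
  by (simp add: fps_mult_nth atLeast0AtMost sum_distrib_left)

lemma fps_conv_radius_mult_pos:
  fixes f g :: "'a :: {banach, real_normed_div_algebra, comm_ring_1} fps"
  assumes "fps_conv_radius f > 0" "fps_conv_radius g > 0"
  shows "fps_conv_radius (f * g) > 0"
  using assms fps_conv_radius_mult[of f g] by (auto simp: min_def split: if_splits)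

lemma fps_conv_radius_diff_pos:
  fixes f g :: "'a :: {banach, real_normed_div_algebra} fps"
  assumes "fps_conv_radius f > 0" "fps_conv_radius g > 0"
  shows "fps_conv_radius (f - g) > 0"
  using assms fps_conv_radius_diff[of f g] by (auto simp: min_def split: if_splits)

text \<open>At the point \<open>1 / (2 * M)\<close> the terms are dominated by
  \<open>(1 / 2) ^ n\<close>, so the radius is at least \<open>1 / (2 * M)\<close>.\<close>

lemma fps_conv_radius_pos_of_bound:
  fixes f :: "complex fps"
  assumes "\<And>n. norm (f $ n) \<le> M ^ n" "M \<ge> 1"
  shows "fps_conv_radius f > 0"
proof -
  let ?z = "of_real (1 / (2 * M)) :: complex"
  have "summable (\<lambda>n. f $ n * ?z ^ n)"
  proof (rule summable_comparison_test')
    show "summable (\<lambda>n. (1 / 2 :: real) ^ n)" by (rule summable_geometric) simp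
    show "norm (f $ n * ?z ^ n) \<le> (1 / 2) ^ n" for n
    proof -
      have "norm (f $ n * ?z ^ n) = norm (f $ n) * (1 / (2 * M)) ^ n"
        using assms(2) by (simp add: norm_mult norm_power norm_divide)
      also have "\<dots> \<le> M ^ n * (1 / (2 * M)) ^ n"
        using assms by (intro mult_right_mono) auto
      also have "\<dots> = (1 / 2) ^ n"
        using assms(2) by (simp add: power_mult_distrib[symmetric])
      finally show ?thesis .
    qed
  qed
  then have "ereal (norm ?z) \<le> fps_conv_radius f"
    unfolding fps_conv_radius_def by (rule conv_radius_geI)
  moreover have "0 < ereal (norm ?z)" using assms(2) by simp
  ultimately show ?thesis by (rule less_le_trans[rotated])
qed

text \<open>At a point r strictly inside the disc of convergence the terms tend to 0, so they are
  bounded by some C; then \<open>M = 1 / r\<close> works.\<close>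

lemma fps_conv_radius_pos_imp_bound:
  fixes f :: "complex fps"
  assumes "fps_conv_radius f > 0"
  shows "\<exists>C M. 0 \<le> M \<and> (\<forall>n. norm (f $ n) \<le> C * M ^ n)"
proof -
  obtain r where r: "0 < ereal r" "ereal r < fps_conv_radius f"
    using ereal_dense2[OF assms] by auto
  have "summable (\<lambda>n. f $ n * of_real r ^ n)"
    using r by (intro summable_fps) auto
  then have "Bseq (\<lambda>n. f $ n * of_real r ^ n)"
    by (intro convergent_imp_Bseq convergentI[of _ 0] summable_LIMSEQ_zero)
  then obtain C where C: "\<And>n. norm (f $ n * of_real r ^ n) \<le> C" by (auto simp: Bseq_def)
  have "norm (f $ n) \<le> C * (1 / r) ^ n" for n
    using C[of n] r by (simp add: norm_mult norm_power field_simps)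
  with r show ?thesis by (intro exI[of _ C] exI[of _ "1 / r"]) auto
qed

section \<open>The dilation by q and the functional U\<close>

context
  fixes q :: complex
  assumes q: "norm q < 1"
begin

definition dil :: "complex fps \<Rightarrow> complex fps" where
  "dil f = fps_compose f (fps_const q * fps_X)"

text \<open>The functional U. As a \<open>suminf\<close> it is meaningful only under convergence,
  which the hypothesis \<open>fps_conv_radius f > 0\<close> secures below.\<close>

definition qsum :: "complex fps \<Rightarrow> complex" where
  "qsum f = (\<Sum>n. f $ n * q ^ (n choose 2))"

lemma dil_nth: "dil f $ n = q ^ n * f $ n"
  by (simp add: dil_def)

lemma dil_simps:
  "dil (f * g) = dil f * dil g" "dil (f - g) = dil f - dil g"
  "dil (fps_const c) = fps_const c" "dil fps_X = fps_const q * fps_X" "dil 1 = 1"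
  by (simp_all add: dil_def fps_compose_mult_distrib fps_compose_sub_distrib)

lemma summable_qsum:
  assumes "fps_conv_radius f > 0"
  shows "summable (\<lambda>n. f $ n * q ^ (n choose 2))"
proof -
  obtain C M where M: "0 \<le> M" "\<And>n. norm (f $ n) \<le> C * M ^ n"
    using fps_conv_radius_pos_imp_bound[OF assms] by auto
  \<comment> \<open>The factor 2 leaves \<open>(1 / 2) ^ n\<close> over as a summable majorant once
    \<open>(2 * M) ^ n\<close> is absorbed by the power of q.\<close>
  obtain K where K: "K \<ge> 0" "\<And>n. (2 * M) ^ n * norm q ^ (n choose 2) \<le> K"
    using power_times_power_choose_bounded[of "norm q" "2 * M"] q M(1) by auto
  have C: "C \<ge> 0" using M(2)[of 0] norm_ge_zero[of "f $ 0"] by (simp del: norm_ge_zero)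
  show ?thesis
  proof (rule summable_comparison_test')
    show "summable (\<lambda>n. C * K * (1 / 2) ^ n)" by (intro summable_mult summable_geometric) simp
    show "norm (f $ n * q ^ (n choose 2)) \<le> C * K * (1 / 2) ^ n" for n
    proof -
      have "norm (f $ n * q ^ (n choose 2)) \<le> C * M ^ n * norm q ^ (n choose 2)"
        unfolding norm_mult norm_power by (intro mult_right_mono M) auto
      also have "\<dots> = C * (1 / 2) ^ n * ((2 * M) ^ n * norm q ^ (n choose 2))"
        by (simp add: power_mult_distrib power_divide)
      also have "\<dots> \<le> C * (1 / 2) ^ n * K"
        using C by (intro mult_left_mono K) auto
      finally show ?thesis by (simp add: mult_ac)
    qed
  qed
qed

text \<open>Multiplication by z moves the coefficient of index n to n + 1, and raising n to n + 1 in
  \<open>n choose 2\<close> adds n to the exponent of q. That extra \<open>q ^ n\<close> is the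
  dilation.\<close>

lemma qsum_X_mult:
  assumes "fps_conv_radius f > 0"
  shows "qsum (fps_X * f) = qsum (dil f)"
proof -
  have "fps_conv_radius (fps_X * f) > 0"
    using assms by (intro fps_conv_radius_mult_pos) auto
  from suminf_split_head[OF summable_qsum[OF this]] show ?thesis
    by (simp add: qsum_def dil_nth power_choose_Suc mult_ac)
qed

lemma fps_conv_radius_dil:
  assumes "fps_conv_radius f > 0"
  shows "fps_conv_radius (dil f) > 0"
proof -
  obtain r where r: "0 < ereal r" "ereal r < fps_conv_radius f"
    using ereal_dense2[OF assms] by auto
  have "summable (\<lambda>n. f $ n * (q * of_real r) ^ n)"
  proof (rule summable_fps)
    have "norm q * r \<le> 1 * r" using q r by (intro mult_right_mono) auto
    then show "ereal (norm (q * of_real r)) < fps_conv_radius f"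
      using r by (auto simp: norm_mult intro: le_less_trans[OF _ r(2)])
  qed
  then have "summable (\<lambda>n. dil f $ n * of_real r ^ n)"
    by (simp add: dil_nth power_mult_distrib mult_ac)
  then have "ereal (norm (of_real r :: complex)) \<le> fps_conv_radius (dil f)"
    unfolding fps_conv_radius_def by (rule conv_radius_geI)
  with r show ?thesis using less_le_trans[OF r(1)] by simp
qed

text \<open>U annihilates z f(z) - f(qz), so a series f with this property certifies a linear
  relation between two values of U. Both functional equations are proved by exhibiting such an
  f.\<close>

lemma qsum_eqI:
  assumes "fps_conv_radius f > 0" "fps_conv_radius g > 0" "fps_conv_radius h > 0"
    and "fps_X * f - dil f = g - fps_const c * h"
  shows "qsum g = c * qsum h"
proof -
  have sum_diff: "qsum (u - v) = qsum u - qsum v"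
    if "fps_conv_radius u > 0" "fps_conv_radius v > 0" for u v
    using suminf_diff[OF summable_qsum[OF that(1)] summable_qsum[OF that(2)]]
    by (simp add: qsum_def algebra_simps)
  have "qsum (fps_X * f - dil f) = 0"
    using assms(1) by (simp add: sum_diff qsum_X_mult fps_conv_radius_mult_pos fps_conv_radius_dil)
  moreover have "qsum (fps_const c * h) = c * qsum h"
    using suminf_mult[OF summable_qsum[OF assms(3)], of c] by (simp add: qsum_def mult_ac)
  ultimately show ?thesis
    using assms by (simp add: sum_diff fps_conv_radius_mult_pos)
qed

text \<open>By the $q$-binomial theorem and Euler's expansions, \<open>fps_P x\<close>, \<open>fps_Q a\<close> and \<open>fps_R b\<close> are
  \<open>(xqz; q)/(qz; q)\<close>, \<open>(az; q)\<close> and \<open>1/(bz\<^sup>2; q\<^sup>2)\<close>, all Pochhammer symbols being infinite;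
  only the resulting $q$-difference equations are needed.\<close>

definition fps_P :: "complex \<Rightarrow> complex fps" where
  "fps_P x = Abs_fps (\<lambda>j. qpoch x q j * q ^ j / qpoch q q j)"

definition fps_Q :: "complex \<Rightarrow> complex fps" where
  "fps_Q a = Abs_fps (\<lambda>k. (- a) ^ k * q ^ (k choose 2) / qpoch q q k)"

definition fps_R :: "complex \<Rightarrow> complex fps" where
  "fps_R b = Abs_fps (\<lambda>m. if even m then b ^ (m div 2) / qpoch (q\<^sup>2) (q\<^sup>2) (m div 2) else 0)"

section \<open>The q-difference equations of the three factors\<close>

lemma one_minus_power_nonzero: "1 - q * q ^ n \<noteq> 0"
  using norm_power_less_one[OF q, of "Suc n"] by auto

lemma one_minus_even_power_nonzero: "1 - q\<^sup>2 * (q\<^sup>2) ^ n \<noteq> 0"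
  using norm_power_less_one[OF norm_power_less_one[OF q, of 2], of "Suc n"] by auto

lemma qpoch_sq_nonzero: "qpoch (q\<^sup>2) (q\<^sup>2) n \<noteq> 0"
  by (rule qpoch_self_nonzero) (use norm_power_less_one[OF q, of 2] in simp)

text \<open>Replacing z by qz in (xqz; q)/(qz; q) deletes the first factors 1 - xqz and 1 - qz. On
  coefficients this is their first-order recurrence.\<close>

lemma fps_P_dil:
  "(1 - fps_const q * fps_X) * fps_P x = (1 - fps_const (x * q) * fps_X) * dil (fps_P x)"
proof (rule fps_ext)
  show "((1 - fps_const q * fps_X) * fps_P x) $ n = ((1 - fps_const (x * q) * fps_X) * dil (fps_P x)) $ n" for n
  proof (cases n)
    case (Suc j)
    have "qpoch x q (Suc j) * q ^ Suc j / qpoch q q (Suc j) * (1 - q ^ Suc j)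
        = q * (1 - x * q ^ j) * (qpoch x q j * q ^ j / qpoch q q j)"
      using one_minus_power_nonzero[of j] qpoch_self_nonzero[OF q, of j]
      by (simp add: qpoch_Suc field_simps)
    then show ?thesis using Suc
      by (simp add: fps_P_def dil_nth left_diff_distrib mult.assoc) (simp add: algebra_simps diff_divide_distrib)
  qed (simp add: fps_P_def dil_nth)
qed

text \<open>Replacing x by xq deletes only the first numerator factor 1 - xqz.\<close>

lemma fps_P_shift: "fps_P x = (1 - fps_const (x * q) * fps_X) * fps_P (x * q)"
proof (rule fps_ext)
  show "fps_P x $ n = ((1 - fps_const (x * q) * fps_X) * fps_P (x * q)) $ n" for n
  proof (cases n)
    case (Suc j)
    have "qpoch x q (Suc j) * q ^ Suc j / qpoch q q (Suc j)
       = qpoch (x * q) q (Suc j) * q ^ Suc j / qpoch q q (Suc j) - x * q * (qpoch (x * q) q j * q ^ j / qpoch q q j)"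
      unfolding qpoch_rec[of x q j] qpoch_Suc[of "x * q"] qpoch_Suc[of q]
      using one_minus_power_nonzero[of j] qpoch_self_nonzero[OF q, of j]
      by (simp add: field_simps)
    then show ?thesis using Suc
      by (simp add: fps_P_def left_diff_distrib mult.assoc)
  qed (simp add: fps_P_def)
qed

lemma fps_Q_dil: "dil (fps_Q a) = fps_Q (a * q)"
  by (rule fps_ext) (simp add: fps_Q_def dil_nth power_uminus_mult mult_ac)

text \<open>Splits the first factor off the infinite product (az; q).\<close>

lemma fps_Q_shift: "fps_Q a = (1 - fps_const a * fps_X) * fps_Q (a * q)"
proof (rule fps_ext)
  show "fps_Q a $ n = ((1 - fps_const a * fps_X) * fps_Q (a * q)) $ n" for n
  proof (cases n)
    case (Suc j)
    have "(- a) ^ Suc j * q ^ (Suc j choose 2) / qpoch q q (Suc j)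
       = (- a * q) ^ Suc j * q ^ (Suc j choose 2) / qpoch q q (Suc j)
         - a * ((- a * q) ^ j * q ^ (j choose 2) / qpoch q q j)"
      unfolding power_mult_distrib power_choose_Suc qpoch_Suc[of q]
      using one_minus_power_nonzero[of j] qpoch_self_nonzero[OF q, of j]
      by (simp add: field_simps)
    then show ?thesis using Suc
      by (simp add: fps_Q_def left_diff_distrib mult.assoc)
  qed (simp add: fps_Q_def)
qed

lemma fps_R_dil: "dil (fps_R b) = fps_R (b * q\<^sup>2)"
  by (rule fps_ext) (auto simp: fps_R_def dil_nth power_mult_distrib elim!: evenE simp flip: power_mult)

text \<open>Passing from b to b q^2 deletes the first factor of the denominator (b z^2;
  q^2).\<close>

lemma fps_R_shift: "fps_R (b * q\<^sup>2) = (1 - fps_const b * fps_X ^ 2) * fps_R b"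
proof (rule fps_ext)
  show "fps_R (b * q\<^sup>2) $ n = ((1 - fps_const b * fps_X ^ 2) * fps_R b) $ n" for n
  proof -
    \<comment> \<open>Multiplication by z^2 shifts indices by two, so the degrees 0 and 1 are
      treated apart.\<close>
    consider "n = 0" | "n = 1" | m where "n = Suc (Suc m)"
      by (metis One_nat_def not0_implies_Suc)
    then show ?thesis
    proof cases
      case 3
      have "(b * q\<^sup>2) ^ Suc l / qpoch (q\<^sup>2) (q\<^sup>2) (Suc l)
         = b ^ Suc l / qpoch (q\<^sup>2) (q\<^sup>2) (Suc l) - b * (b ^ l / qpoch (q\<^sup>2) (q\<^sup>2) l)" for l
        unfolding power_mult_distrib qpoch_Suc[of "q\<^sup>2"]
        using one_minus_even_power_nonzero[of l] qpoch_sq_nonzero[of l]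
        by (simp add: field_simps)
      with 3 show ?thesis
        by (simp add: fps_R_def left_diff_distrib mult.assoc fps_X_power_mult_nth)
    qed (simp_all add: fps_R_def left_diff_distrib mult.assoc fps_X_power_mult_nth)
  qed
qed

section \<open>Geometric bounds for the coefficients\<close>

lemma norm_fps_P_nth: "norm (fps_P x $ n) \<le> ((1 + norm x) / (1 - norm q)) ^ n"
proof -
  have "norm (fps_P x $ n) = norm (qpoch x q n) * norm q ^ n / norm (qpoch q q n)"
    by (simp add: fps_P_def norm_mult norm_divide norm_power)
  also have "\<dots> \<le> (1 + norm x) ^ n * 1 / (1 - norm q) ^ n"
    using q by (intro frac_le mult_mono norm_qpoch_le norm_qpoch_self_ge) (auto intro: power_le_one)
  finally show ?thesis by (simp add: power_divide)
qed

lemma norm_fps_Q_nth: "norm (fps_Q a $ n) \<le> (norm a / (1 - norm q)) ^ n"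
proof -
  have "norm (fps_Q a $ n) = norm a ^ n * norm q ^ (n choose 2) / norm (qpoch q q n)"
    by (simp add: fps_Q_def norm_mult norm_divide norm_power)
  also have "\<dots> \<le> norm a ^ n * 1 / (1 - norm q) ^ n"
    using q by (intro frac_le mult_mono norm_qpoch_self_ge) (auto intro: power_le_one)
  finally show ?thesis by (simp add: power_divide)
qed

text \<open>Degree n = 2l carries only the l-th power of b, which yields \<open>M ^ l\<close>; the
  hypothesis \<open>1 \<le> M\<close> raises this to \<open>M ^ n\<close>. The denominator is
  handled by |q^2| \<le> |q|.\<close>

lemma norm_fps_R_nth:
  assumes "norm b / (1 - norm q) \<le> M" "1 \<le> M"
  shows "norm (fps_R b $ n) \<le> M ^ n"
proof (cases "even n")
  case True
  then obtain l where l: "n = 2 * l" by (auto elim: evenE)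
  have q2: "norm (q\<^sup>2) < 1" using norm_power_less_one[OF q, of 2] by simp
  have "norm (q\<^sup>2) \<le> norm q"
    using q mult_left_mono[of "norm q" 1 "norm q"] by (simp add: norm_mult power2_eq_square)
  then have "(1 - norm q) ^ l \<le> (1 - norm (q\<^sup>2)) ^ l"
    using q by (intro power_mono) auto
  also have "\<dots> \<le> norm (qpoch (q\<^sup>2) (q\<^sup>2) l)" by (rule norm_qpoch_self_ge[OF q2])
  finally have "norm (fps_R b $ n) \<le> norm b ^ l / (1 - norm q) ^ l"
    using q by (auto simp: fps_R_def l norm_divide norm_power intro!: frac_le)
  also have "\<dots> \<le> M ^ l"
    using assms q by (subst power_divide[symmetric]) (intro power_mono, auto)
  also have "\<dots> \<le> M ^ n" using assms by (intro power_increasing) (auto simp: l)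
  finally show ?thesis .
qed (use assms in \<open>simp add: fps_R_def\<close>)

text \<open>One M serves all x and y of norm at most Y, as uniform convergence requires. The
  exponent 3 comes from x^2 y: (1 + Y)^3 dominates 1 + |x|, |xy| and |x^2 y|.\<close>

lemma coefficient_bounds:
  assumes "norm x \<le> Y" "norm y \<le> Y" "M = (1 + Y) ^ 3 / (1 - norm q)"
  shows "1 \<le> M" "norm (fps_P x $ n) \<le> M ^ n" "norm (fps_Q (x * y) $ n) \<le> M ^ n"
    "norm (fps_R (x\<^sup>2 * y) $ n) \<le> M ^ n"
proof -
  have Y: "0 \<le> Y" using norm_ge_zero[of x] assms(1) by linarith
  have 1: "1 + Y \<le> (1 + Y) ^ 3" using power_increasing[of 1 3 "1 + Y"] Y by simp
  have c: "t / (1 - norm q) \<le> M" if "t \<le> (1 + Y) ^ 3" for t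
    using q that unfolding assms(3) by (intro divide_right_mono) auto
  have "1 - norm q \<le> (1 + Y) ^ 3" using 1 Y norm_ge_zero[of q] by linarith
  then show M: "1 \<le> M" using q unfolding assms(3) by simp
  have p2: "(1 + Y)\<^sup>2 \<le> (1 + Y) ^ 3" using Y by (intro power_increasing) auto
  have "norm (x * y) \<le> (1 + Y) * (1 + Y)"
    unfolding norm_mult using assms Y by (intro mult_mono) auto
  then have 2: "norm (x * y) \<le> (1 + Y) ^ 3" using p2 by (simp add: power2_eq_square)
  have "norm (x\<^sup>2 * y) \<le> (1 + Y)\<^sup>2 * (1 + Y)"
    unfolding norm_mult norm_power using assms Y by (intro mult_mono power_mono) auto
  then have 3: "norm (x\<^sup>2 * y) \<le> (1 + Y) ^ 3" by (simp add: power2_eq_square power3_eq_cube)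
  have "((1 + norm x) / (1 - norm q)) ^ n \<le> M ^ n"
    using c[of "1 + norm x"] 1 assms(1) q by (intro power_mono) auto
  then show "norm (fps_P x $ n) \<le> M ^ n" using norm_fps_P_nth[of x n] by linarith
  have "(norm (x * y) / (1 - norm q)) ^ n \<le> M ^ n"
    using c[OF 2] q by (intro power_mono) auto
  then show "norm (fps_Q (x * y) $ n) \<le> M ^ n" using norm_fps_Q_nth[of "x * y" n] by linarith
  show "norm (fps_R (x\<^sup>2 * y) $ n) \<le> M ^ n" using c[OF 3] M by (rule norm_fps_R_nth)
qed

lemma fps_conv_radius_P: "fps_conv_radius (fps_P x) > 0"
  by (rule fps_conv_radius_pos_of_bound)
     (rule coefficient_bounds[of x "norm x" 0, OF _ _ refl], auto)+

lemma fps_conv_radius_Q: "fps_conv_radius (fps_Q a) > 0"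
proof (rule fps_conv_radius_pos_of_bound)
  let ?M = "max 1 (norm a / (1 - norm q))"
  show "norm (fps_Q a $ n) \<le> ?M ^ n" for n
    by (rule order.trans[OF norm_fps_Q_nth]) (use q in \<open>auto intro!: power_mono\<close>)
qed simp

lemma fps_conv_radius_R: "fps_conv_radius (fps_R b) > 0"
  by (rule fps_conv_radius_pos_of_bound[where M = "max 1 (norm b / (1 - norm q))"])
     (auto intro: norm_fps_R_nth)

section \<open>The functional equations of F\<close>

definition fps_A :: "complex \<Rightarrow> complex \<Rightarrow> complex fps" where
  "fps_A x y = fps_P x * (fps_Q (x * y) * fps_R (x\<^sup>2 * y))"

lemmas conv_radius_pos_intros =
  fps_conv_radius_mult_pos fps_conv_radius_diff_pos fps_conv_radius_P fps_conv_radius_Q fps_conv_radius_R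

lemma fps_conv_radius_A: "fps_conv_radius (fps_A x y) > 0"
  unfolding fps_A_def by (intro conv_radius_pos_intros)

lemma qsum_A_shift: "qsum (fps_A x y) = (1 - x * y) * qsum (fps_A x (y * q\<^sup>2))"
proof -
  define B where "B = fps_P x * (fps_Q (x * y * q * q) * fps_R (x\<^sup>2 * y))"
  \<comment> \<open>The constant series become atoms, so that the final identity is a polynomial one
    in them, \<open>fps_X\<close> and \<open>B\<close>, within reach of
    \<open>algebra\<close>.\<close>
  define Xq where "Xq = fps_const q"
  define cx where "cx = fps_const x"
  define cy where "cy = fps_const y"
  have A: "fps_A x y = (1 - cx * cy * fps_X) * (1 - cx * cy * Xq * fps_X) * B"
    unfolding fps_A_def B_def fps_Q_shift[of "x * y"] fps_Q_shift[of "x * y * q"]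
    by (simp add: mult_ac Xq_def cx_def cy_def)
  have A': "fps_A x (y * q\<^sup>2) = (1 - cx\<^sup>2 * cy * fps_X ^ 2) * B"
    using fps_R_shift[of "x\<^sup>2 * y"] unfolding fps_A_def B_def
    by (simp add: mult_ac power2_eq_square Xq_def cx_def cy_def)
  have Q: "fps_Q (x * y * q * q) = (1 - cx * cy * Xq * Xq * fps_X) * dil (fps_Q (x * y * q * q))"
    unfolding fps_Q_dil by (subst fps_Q_shift) (simp add: Xq_def cx_def cy_def)
  have R: "dil (fps_R (x\<^sup>2 * y)) = (1 - cx\<^sup>2 * cy * fps_X ^ 2) * fps_R (x\<^sup>2 * y)"
    unfolding fps_R_dil fps_R_shift by (simp add: cx_def cy_def power2_eq_square)
  have P: "(1 - cx * Xq * fps_X) * dil (fps_P x) = (1 - Xq * fps_X) * fps_P x"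
    using fps_P_dil[of x] by (simp add: Xq_def cx_def)
  \<comment> \<open>The q-difference equation of \<open>B\<close> is the product of those of its
    three factors.\<close>
  have B: "(1 - cx * Xq * fps_X) * (1 - cx * cy * Xq * Xq * fps_X) * dil B
      = (1 - Xq * fps_X) * (1 - cx\<^sup>2 * cy * fps_X ^ 2) * B" (is "?l = ?r")
  proof -
    have "?l = ((1 - cx * Xq * fps_X) * dil (fps_P x))
          * ((1 - cx * cy * Xq * Xq * fps_X) * dil (fps_Q (x * y * q * q))) * dil (fps_R (x\<^sup>2 * y))"
      unfolding B_def by (simp only: dil_simps mult_ac)
    also have "\<dots> = ?r" unfolding P R Q[symmetric] B_def by (simp only: mult_ac)
    finally show ?thesis .
  qed
  \<comment> \<open>Dilation turns the two linear factors into 1 - xqz and 1 - xyq^2 z, exactly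
    those multiplying \<open>dil B\<close> in its equation. Hence \<open>dil f\<close> is again a
    polynomial times \<open>B\<close>.\<close>
  define f where "f = fps_const (- (x * y)) * ((1 - fps_const x * fps_X) * (1 - fps_const (x * y * q) * fps_X) * B)"
  have f: "f = - cx * cy * (1 - cx * fps_X) * (1 - cx * cy * Xq * fps_X) * B"
    unfolding f_def cx_def cy_def Xq_def by (simp add: mult_ac)
  have df: "dil f = - cx * cy * ((1 - cx * Xq * fps_X) * (1 - cx * cy * Xq * Xq * fps_X) * dil B)"
    unfolding f_def dil_simps cx_def cy_def Xq_def by (simp add: mult_ac)
  show ?thesis
  proof (rule qsum_eqI)
    show "fps_conv_radius f > 0"
      unfolding f_def B_def by (intro conv_radius_pos_intros) auto
    have c: "fps_const (1 - x * y) = 1 - cx * cy" by (simp add: cx_def cy_def)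
    show "fps_X * f - dil f = fps_A x y - fps_const (1 - x * y) * fps_A x (y * q\<^sup>2)"
      unfolding df unfolding B A A' f c by algebra
  qed (rule fps_conv_radius_A)+
qed

lemma fps_A_zero: "fps_A x 0 = fps_P x"
proof -
  have "fps_Q 0 = 1" "fps_R 0 = 1"
    by (rule fps_ext; auto simp: fps_Q_def fps_R_def power_0_left binomial_eq_0 elim!: evenE)+
  then show ?thesis by (simp add: fps_A_def)
qed

lemma qsum_A_zero_shift: "qsum (fps_A x 0) = (1 - q * x) * qsum (fps_A (x * q\<^sup>2) 0)"
proof -
  define B where "B = fps_P (x * q * q)"
  define Xq where "Xq = fps_const q"
  define cx where "cx = fps_const x"
  have A: "fps_A x 0 = (1 - cx * Xq * fps_X) * (1 - cx * Xq * Xq * fps_X) * B"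
    unfolding fps_A_zero B_def fps_P_shift[of x] fps_P_shift[of "x * q"]
    by (simp add: mult_ac Xq_def cx_def)
  have A': "fps_A (x * q\<^sup>2) 0 = B"
    by (simp add: fps_A_zero B_def power2_eq_square mult.assoc)
  have B: "(1 - cx * Xq * Xq * Xq * fps_X) * dil B = (1 - Xq * fps_X) * B"
    using fps_P_dil[of "x * q * q"] by (simp add: B_def cx_def Xq_def)
  \<comment> \<open>The linear factor dilates to 1 - xq^3 z, the one that multiplies
    \<open>dil B\<close> in its equation.\<close>
  define f where "f = fps_const (- (q * x)) * ((1 - fps_const (x * q * q) * fps_X) * B)"
  have f: "f = - Xq * cx * (1 - cx * Xq * Xq * fps_X) * B"
    unfolding f_def cx_def Xq_def by (simp add: mult_ac)
  have df: "dil f = - Xq * cx * ((1 - cx * Xq * Xq * Xq * fps_X) * dil B)"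
    unfolding f_def dil_simps cx_def Xq_def by (simp add: mult_ac)
  show ?thesis
  proof (rule qsum_eqI)
    show "fps_conv_radius f > 0"
      unfolding f_def B_def by (intro conv_radius_pos_intros) auto
    have c: "fps_const (1 - q * x) = 1 - Xq * cx" by (simp add: cx_def Xq_def)
    show "fps_X * f - dil f = fps_A x 0 - fps_const (1 - q * x) * fps_A (x * q\<^sup>2) 0"
      unfolding df unfolding B A A' f c by algebra
  qed (rule fps_conv_radius_A)+
qed

text \<open>At x = 1 every \<open>qpoch 1 q n\<close> with n > 0 contains the factor 1 - 1, so the
  series collapses to its constant term.\<close>

lemma qsum_A_one_zero: "qsum (fps_A 1 0) = 1"
proof -
  have "fps_P 1 = 1"
    by (rule fps_ext) (auto simp: fps_P_def qpoch_rec gr0_conv_Suc)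
  moreover have "qsum 1 = 1"
    unfolding qsum_def by (subst suminf_finite[of "{0}"]) (auto simp: binomial_eq_0)
  ultimately show ?thesis by (simp add: fps_A_zero)
qed

section \<open>Absolute convergence of the triple sum and continuity of F\<close>

text \<open>The third index is the degree m in z rather than l = m/2, so that j + k + m is the total
  degree in the product of the three series.\<close>

definition triple_term :: "complex \<Rightarrow> complex \<Rightarrow> nat \<times> nat \<times> nat \<Rightarrow> complex" where
  "triple_term x y = (\<lambda>(j, k, m). fps_P x $ j * (fps_Q (x * y) $ k * fps_R (x\<^sup>2 * y) $ m) * q ^ ((j + k + m) choose 2))"

text \<open>K depends on Y alone, which makes this a uniform majorant for the Weierstrass
  test.\<close>

lemma triple_term_bound:
  "\<exists>K. \<forall>x y j k m. norm x \<le> Y \<longrightarrow> norm y \<le> Y \<longrightarrow>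
     norm (triple_term x y (j, k, m)) \<le> K * ((1 / 2) ^ j * ((1 / 2) ^ k * (1 / 2) ^ m))"
proof (cases "Y \<ge> 0")
  case True
  define M where "M = (1 + Y) ^ 3 / (1 - norm q)"
  have M: "1 \<le> M" using coefficient_bounds(1)[of 0 Y 0 M] True by (simp add: M_def)
  obtain K where K: "K \<ge> 0" "\<And>n. (2 * M) ^ n * norm q ^ (n choose 2) \<le> K"
    using power_times_power_choose_bounded[of "norm q" "2 * M"] q M by auto
  have "norm (triple_term x y (j, k, m)) \<le> K * ((1 / 2) ^ j * ((1 / 2) ^ k * (1 / 2) ^ m))"
    if xy: "norm x \<le> Y" "norm y \<le> Y" for x y j k m
  proof -
    have "norm (triple_term x y (j, k, m)) \<le> M ^ j * (M ^ k * M ^ m) * norm q ^ ((j + k + m) choose 2)"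
      unfolding triple_term_def prod.case norm_mult norm_power
      using M by (intro mult_mono coefficient_bounds(2-)[OF xy M_def]) auto
    also have "\<dots> = (1 / 2) ^ (j + k + m) * ((2 * M) ^ (j + k + m) * norm q ^ ((j + k + m) choose 2))"
      by (simp add: power_mult_distrib power_divide power_add)
    also have "\<dots> \<le> (1 / 2) ^ (j + k + m) * K"
      by (intro mult_left_mono K) auto
    finally show ?thesis by (simp add: power_add mult_ac)
  qed
  then show ?thesis by blast
next
  case False
  then have "\<not> norm x \<le> Y" for x :: complex using norm_ge_zero[of x] by linarith
  then show ?thesis by blast
qed

text \<open>Absolute summability permits grouping by total degree, and each group is a coefficient
  of the product \<open>fps_A x y\<close> times its power of q.\<close>

lemma triple_term_has_sum: "(triple_term x y has_sum qsum (fps_A x y)) UNIV"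
proof -
  obtain K where K: "norm (triple_term x y (j, k, m)) \<le> K * ((1 / 2) ^ j * ((1 / 2) ^ k * (1 / 2) ^ m))" for j k m
    using triple_term_bound[of "max (norm x) (norm y)"] by (metis max.cobounded1 max.cobounded2)
  have "(\<lambda>p. K * (case p of (j, k, m) \<Rightarrow> (1 / 2) ^ j * ((1 / 2) ^ k * (1 / 2) ^ m))) summable_on UNIV"
    by (intro summable_on_cmult_right summable_on_half_powers)
  then have "(\<lambda>p. norm (triple_term x y p)) summable_on UNIV"
    by (rule summable_on_comparison_test) (use K in \<open>auto\<close>)
  then have s: "triple_term x y summable_on UNIV" by (rule abs_summable_summable)
  have "(\<lambda>n. \<Sum>j\<le>n. \<Sum>k\<le>n - j. triple_term x y (j, k, n - j - k)) = (\<lambda>n. fps_A x y $ n * q ^ (n choose 2))"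
    by (auto simp: triple_term_def fps_A_def fps_mult3_nth sum_distrib_right intro!: sum.cong)
  with has_sum_imp_sums[OF has_sum_by_total_degree[OF has_sum_infsum[OF s]]]
  have "infsum (triple_term x y) UNIV = qsum (fps_A x y)"
    unfolding qsum_def by (simp add: sums_iff)
  with has_sum_infsum[OF s] show ?thesis by simp
qed

text \<open>The finite partial sums are polynomials in x and y, and by the Weierstrass test they
  converge uniformly on bounded sets.\<close>

lemma continuous_on_qsum_A:
  "continuous_on {(x, y). norm x \<le> Y \<and> norm y \<le> Y} (\<lambda>(x, y). qsum (fps_A x y))" (is "continuous_on ?S _")
proof -
  obtain K where K: "\<And>x y j k m. norm x \<le> Y \<Longrightarrow> norm y \<le> Y \<Longrightarrow>
      norm (triple_term x y (j, k, m)) \<le> K * ((1 / 2) ^ j * ((1 / 2) ^ k * (1 / 2) ^ m))"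
    using triple_term_bound by metis
  show ?thesis
  proof (rule uniform_limit_theorem)
    show "uniform_limit ?S (\<lambda>X p. \<Sum>t\<in>X. (\<lambda>(x, y). triple_term x y t) p) (\<lambda>(x, y). qsum (fps_A x y)) (finite_subsets_at_top UNIV)"
    proof (rule Weierstrass_m_test_general')
      show "(\<lambda>p. K * (case p of (j, k, m) \<Rightarrow> (1 / 2) ^ j * ((1 / 2) ^ k * (1 / 2) ^ m))) summable_on UNIV"
        by (intro summable_on_cmult_right summable_on_half_powers)
    qed (use K triple_term_has_sum in auto)
    have "continuous_on ?S (\<lambda>(x, y). triple_term x y t)" for t
      by (cases t; cases "even (snd (snd t))")
         (auto simp: triple_term_def fps_P_def fps_Q_def fps_R_def qpoch_def case_prod_unfold
           divide_inverse intro!: continuous_intros)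
    then show "\<forall>\<^sub>F X in finite_subsets_at_top UNIV. continuous_on ?S (\<lambda>p. \<Sum>t\<in>X. (\<lambda>(x, y). triple_term x y t) p)"
      by (intro always_eventually allI continuous_on_sum)
  qed simp
qed

section \<open>Iterating the functional equations\<close>

lemma tendsto_even_powers: "(\<lambda>n. c * (q\<^sup>2) ^ n) \<longlonglongrightarrow> 0"
  using norm_power_less_one[OF q, of 2]
  by (auto intro!: tendsto_eq_intros LIMSEQ_power_zero)

lemma norm_even_power_le: "norm (c * (q\<^sup>2) ^ n) \<le> norm c"
proof -
  have "norm (c * (q\<^sup>2) ^ n) \<le> norm c * 1"
    unfolding norm_mult using norm_power_less_one[OF q, of 2]
    by (intro mult_left_mono) (auto simp: norm_power power_le_one)
  then show ?thesis by simp
qed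

lemma qsum_A_tendsto:
  "(\<lambda>n. qsum (fps_A (x * (q\<^sup>2) ^ n) 0)) \<longlonglongrightarrow> qsum (fps_A 0 0)"
  "(\<lambda>n. qsum (fps_A x (y * (q\<^sup>2) ^ n))) \<longlonglongrightarrow> qsum (fps_A x 0)"
proof -
  have lim: "(\<lambda>n. qsum (fps_A (fst (s n)) (snd (s n)))) \<longlonglongrightarrow> qsum (fps_A (fst l) (snd l))"
    if "s \<longlonglongrightarrow> l" "\<And>n. norm (fst (s n)) \<le> Y \<and> norm (snd (s n)) \<le> Y" "norm (fst l) \<le> Y \<and> norm (snd l) \<le> Y"
    for s l Y
    using continuous_on_tendsto_compose[OF continuous_on_qsum_A[of Y] that(1)] that(2,3)
    by (simp add: case_prod_unfold)
  show "(\<lambda>n. qsum (fps_A (x * (q\<^sup>2) ^ n) 0)) \<longlonglongrightarrow> qsum (fps_A 0 0)"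
    using lim[of "\<lambda>n. (x * (q\<^sup>2) ^ n, 0)" "(0, 0)" "norm x"]
    by (simp add: tendsto_Pair tendsto_even_powers norm_even_power_le)
  show "(\<lambda>n. qsum (fps_A x (y * (q\<^sup>2) ^ n))) \<longlonglongrightarrow> qsum (fps_A x 0)"
    using lim[of "\<lambda>n. (x, y * (q\<^sup>2) ^ n)" "(x, 0)" "max (norm x) (norm y)"] norm_even_power_le[of y]
    by (simp add: tendsto_Pair tendsto_even_powers le_max_iff_disj)
qed

lemma qpoch_sq_LIMSEQ: "qpoch a (q\<^sup>2) \<longlonglongrightarrow> qpoch_inf a (q\<^sup>2)"
  by (rule qpoch_LIMSEQ) (use norm_power_less_one[OF q, of 2] in simp)

text \<open>Using \<open>qsum_A_shift\<close> n times collects the finite product while the second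
  argument shrinks to 0; continuity justifies the limit.\<close>

lemma qsum_A_eq: "qsum (fps_A x y) = qpoch_inf (x * y) (q\<^sup>2) * qsum (fps_A x 0)"
proof -
  have eq: "qsum (fps_A x y) = qpoch (x * y) (q\<^sup>2) n * qsum (fps_A x (y * (q\<^sup>2) ^ n))" for n
  proof (induction n)
    case (Suc n)
    then show ?case
      using qsum_A_shift[of x "y * (q\<^sup>2) ^ n"] by (simp add: qpoch_Suc mult_ac)
  qed simp
  have "(\<lambda>n. qsum (fps_A x y)) \<longlonglongrightarrow> qpoch_inf (x * y) (q\<^sup>2) * qsum (fps_A x 0)"
    using tendsto_mult[OF qpoch_sq_LIMSEQ qsum_A_tendsto(2), of "x * y" x y] by (simp only: eq[symmetric])
  then show ?thesis by (simp add: LIMSEQ_const_iff)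
qed

lemma qsum_A_zero_eq: "qsum (fps_A x 0) = qpoch_inf (q * x) (q\<^sup>2) * qsum (fps_A 0 0)"
proof -
  have eq: "qsum (fps_A x 0) = qpoch (q * x) (q\<^sup>2) n * qsum (fps_A (x * (q\<^sup>2) ^ n) 0)" for n
  proof (induction n)
    case (Suc n)
    then show ?case
      using qsum_A_zero_shift[of "x * (q\<^sup>2) ^ n"] by (simp add: qpoch_Suc mult_ac)
  qed simp
  have "(\<lambda>n. qsum (fps_A x 0)) \<longlonglongrightarrow> qpoch_inf (q * x) (q\<^sup>2) * qsum (fps_A 0 0)"
    using tendsto_mult[OF qpoch_sq_LIMSEQ qsum_A_tendsto(1), of "q * x" x] by (simp only: eq[symmetric])
  then show ?thesis by (simp add: LIMSEQ_const_iff)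
qed

section \<open>Euler's identity and the value F(0, 0)\<close>

text \<open>Finite form: (q; q^2)_n (-q; q)_n (q; q)_n = (q; q)_{2n}, from splitting even and odd
  exponents. Both sides contain (q; q)_\<infinity> in the limit, and it is nonzero, so it
  cancels.\<close>

lemma Euler_odd_distinct: "qpoch_inf q (q\<^sup>2) * qpoch_inf (- q) q = 1"
proof -
  have fin: "qpoch q (q\<^sup>2) n * qpoch (- q) q n * qpoch q q n = qpoch q q (2 * n)" for n
  proof (induction n)
    case (Suc n)
    have "qpoch q q (2 * Suc n) = qpoch q q (2 * n) * (1 - q * q ^ (2 * n)) * (1 - (q * q ^ n)\<^sup>2)"
      by (simp add: qpoch_Suc power_mult_distrib power_even_eq power2_eq_square mult.assoc)
    also have "\<dots> = (qpoch q (q\<^sup>2) n * (1 - q * (q\<^sup>2) ^ n)) * (qpoch (- q) q n * (1 + q * q ^ n)) * (qpoch q q n * (1 - q * q ^ n))"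
      unfolding Suc.IH[symmetric] power_mult by algebra
    finally show ?case by (simp add: qpoch_Suc)
  qed simp
  have lim: "qpoch q q \<longlonglongrightarrow> qpoch_inf q q" by (rule qpoch_LIMSEQ[OF q])
  have "strict_mono (\<lambda>n::nat. 2 * n)" by (simp add: strict_mono_def)
  from LIMSEQ_subseq_LIMSEQ[OF lim this]
  have "(\<lambda>n. qpoch q (q\<^sup>2) n * qpoch (- q) q n * qpoch q q n) \<longlonglongrightarrow> qpoch_inf q q"
    by (simp add: fin o_def)
  moreover have "(\<lambda>n. qpoch q (q\<^sup>2) n * qpoch (- q) q n * qpoch q q n)
      \<longlonglongrightarrow> qpoch_inf q (q\<^sup>2) * qpoch_inf (- q) q * qpoch_inf q q"
    by (intro tendsto_mult qpoch_sq_LIMSEQ qpoch_LIMSEQ q)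
  ultimately have "qpoch_inf q (q\<^sup>2) * qpoch_inf (- q) q * qpoch_inf q q = qpoch_inf q q"
    by (rule LIMSEQ_unique[rotated])
  moreover have "qpoch_inf q q \<noteq> 0"
    unfolding qpoch_inf_def
    by (rule prodinf_nonzero[OF convergent_prod_qpoch_inf[OF q] one_minus_power_nonzero])
  ultimately show ?thesis by simp
qed

text \<open>The case x = 1 reads 1 = (q; q^2)_\<infinity> F(0, 0); multiplying by (-q;
  q)_\<infinity> and using Euler's identity isolates F(0, 0).\<close>

lemma qsum_A_zero_zero: "qsum (fps_A 0 0) = qpoch_inf (- q) q"
  using qsum_A_zero_eq[of 1] qsum_A_one_zero Euler_odd_distinct
  by (metis mult.right_neutral mult.left_commute)

lemma qsum_A_closed_form:
  "qsum (fps_A x y) = qpoch_inf (q * x) (q\<^sup>2) * qpoch_inf (x * y) (q\<^sup>2) * qpoch_inf (- q) q"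
  by (simp add: qsum_A_eq[of x y] qsum_A_zero_eq[of x] qsum_A_zero_zero mult_ac)

end

section \<open>Reindexing to the triple sum in j, k, l\<close>

theorem theorem1p4:
  fixes q x y :: complex
  assumes "norm q < 1"
  shows "((\<lambda>(j, k, l).
            qpoch x q j * (- x) ^ (k + 2 * l) * y ^ (k + l)
              / (qpoch q q j * qpoch q q k * qpoch (q ^ 2) (q ^ 2) l)
              * q ^ (j + (k choose 2) + ((j + k + 2 * l) choose 2)))
          has_sum
          (qpoch_inf (q * x) (q ^ 2) * qpoch_inf (x * y) (q ^ 2) * qpoch_inf (- q) q))
         (UNIV :: (nat \<times> nat \<times> nat) set)"
proof -
  let ?h = "\<lambda>(j, k, l). (j, k, 2 * l) :: nat \<times> nat \<times> nat"
  have "(triple_term q x y has_sum qsum q (fps_A q x y)) (range ?h)"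
  \<comment> \<open>Outside the range of \<open>?h\<close> the third index is odd, and
    \<open>fps_R\<close> has only even powers, so no nonzero term is lost.\<close>
  proof (rule has_sum_cong_neutral[THEN iffD1, OF _ _ _ triple_term_has_sum[OF assms]])
    fix t assume "t \<in> UNIV - range ?h"
    then have "odd (snd (snd t))" by (cases t) (auto elim!: evenE simp: image_iff)
    then show "triple_term q x y t = 0"
      by (cases t) (simp add: triple_term_def[OF assms] fps_R_def[OF assms])
  qed auto
  then have "(triple_term q x y \<circ> ?h has_sum qsum q (fps_A q x y)) UNIV"
    by (subst (asm) has_sum_reindex) (auto simp: inj_def)
  \<comment> \<open>Serves to match \<open>(- (x * y)) ^ k * (x\<^sup>2 * y) ^ l\<close> with
    \<open>(- x) ^ (k + 2 * l) * y ^ (k + l)\<close>.\<close>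
  moreover have pow: "x ^ (l * 2) = (x\<^sup>2) ^ l" for l
    by (metis mult.commute power_mult)
  have "triple_term q x y \<circ> ?h = (\<lambda>(j, k, l).
       qpoch x q j * (- x) ^ (k + 2 * l) * y ^ (k + l)
         / (qpoch q q j * qpoch q q k * qpoch (q ^ 2) (q ^ 2) l)
         * q ^ (j + (k choose 2) + ((j + k + 2 * l) choose 2)))"
    by (simp add: fun_eq_iff triple_term_def[OF assms] fps_P_def[OF assms] fps_Q_def[OF assms]
        fps_R_def[OF assms] power_add pow power_mult_distrib power_uminus_mult mult_ac)
  ultimately show ?thesis
    by (simp only: qsum_A_closed_form[OF assms])
qed

end
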